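(* Let $X$ be a finite dimensional normed vector space and let $Y$ be a Banach space which is an $\mathcal L^\infty_\lambda$ space for every $\lambda>1$. Then $\widetilde{\mathcal A}(X,Y)=(0,1]$. In particular, for every compact space $K$, $\widetilde{\mathcal A}(X,C(K))=(0,1]$.
   Context: For $\lambda>1$, a Banach space $Y$ is an $\mathcal L^\infty_\lambda$ space if every finite dimensional subspace of $Y$ is contained in a finite dimensional subspace $F$ of $Y$ which is $\lambda$-isomorphic to $\ell_\infty^{\dim F}$, i.e. there is an isomorphism $T$ from $F$ onto $\ell_\infty^{\dim F}$ with $\|T\|\,\|T^{-1}\|\le\lambda$. For a compact space $K$, $C(K)$ is the space of all real valued continuous functions on $K$ with the supremum norm. For metric spaces $(X,d)$, $(Y,\varrho)$, $\alpha\in(0,1]$ and $L>0$, a map $f:X\to Y$ is called $(L,\alpha)$-Hölder if $\varrho(f(x),f(y))\le L d(x,y)^\alpha$ for all $x,y\in X$. For $C\ge 1$, $\mathcal B_C(X,Y)$ denotes the set of all $\alpha\in(0,1]$ such that for every $L>0$ and every subset $M\subset X$, any $(L,\alpha)$-Hölder function $f:M\to Y$ can be extended to a $(CL,\alpha)$-Hölder function from $X$ into $Y$. Set $\widetilde{\mathcal A}(X,Y)=\bigcap_{C>1}\mathcal B_C(X,Y)$. Normed spaces are viewed as metric spaces with the norm distance. *)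

theory Defs
  imports "HOL-Analysis.Analysis"
begin

text \<open>Vector spaces and their subspaces are real throughout.\<close>

definition fin_dim_subspace :: "'a::real_vector set \<Rightarrow> bool" where
  "fin_dim_subspace S \<longleftrightarrow> subspace S \<and> (\<exists>B. finite B \<and> span B = S)"

text \<open>
  Bounded linear operators on a subspace. The library's \<open>bounded_linear\<close> and \<open>onorm\<close>
  only treat operators on a whole type; the values of \<open>T\<close> outside \<open>E\<close> are irrelevant here.
  As in \<open>onorm\<close>, the vector \<open>0\<close> contributes \<open>0 / 0 = 0\<close> to the supremum,
  so that the norm is \<open>0\<close> on the zero space.
\<close>

definition bounded_linear_on ::
  "'a::real_normed_vector set \<Rightarrow> ('a \<Rightarrow> 'b::real_normed_vector) \<Rightarrow> bool" where
  "bounded_linear_on E T \<longleftrightarrow>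
     (\<forall>x\<in>E. \<forall>y\<in>E. T (x + y) = T x + T y) \<and>
     (\<forall>r. \<forall>x\<in>E. T (r *\<^sub>R x) = r *\<^sub>R T x) \<and>
     (\<exists>K. \<forall>x\<in>E. norm (T x) \<le> norm x * K)"

definition onorm_on ::
  "'a::real_normed_vector set \<Rightarrow> ('a \<Rightarrow> 'b::real_normed_vector) \<Rightarrow> real" where
  "onorm_on E T = (SUP x\<in>E. norm (T x) / norm x)"

definition lambda_isomorphic ::
  "real \<Rightarrow> 'a::real_normed_vector set \<Rightarrow> 'b::real_normed_vector set \<Rightarrow> bool" where
  "lambda_isomorphic l E F \<longleftrightarrow>
     (\<exists>T. bij_betw T E F \<and> bounded_linear_on E T \<and> bounded_linear_on F (inv_into E T) \<and>
          onorm_on E T * onorm_on F (inv_into E T) \<le> l)"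

text \<open>
  \<open>nat\<close> carries the discrete topology, so \<open>nat \<Rightarrow>\<^sub>C real\<close> is the space of all bounded real
  sequences with the supremum norm. The \<open>n\<close>-dimensional space $\ell_\infty^n$ is realised in it
  as the subspace of the sequences supported on the first \<open>n\<close> indices.
\<close>

definition ell_infty :: "nat \<Rightarrow> (nat \<Rightarrow>\<^sub>C real) set" where
  "ell_infty n = {v. \<forall>i\<ge>n. apply_bcontfun v i = 0}"

definition script_L_infty :: "real \<Rightarrow> 'b::banach itself \<Rightarrow> bool" where
  "script_L_infty l (_ :: 'b itself) \<longleftrightarrow>
     (\<forall>E :: 'b set. fin_dim_subspace E \<longrightarrow>
        (\<exists>F. fin_dim_subspace F \<and> E \<subseteq> F \<and> lambda_isomorphic l F (ell_infty (dim F))))"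

definition holder_on ::
  "real \<Rightarrow> real \<Rightarrow> 'a::metric_space set \<Rightarrow> ('a \<Rightarrow> 'b::metric_space) \<Rightarrow> bool" where
  "holder_on L \<alpha> M f \<longleftrightarrow> (\<forall>x\<in>M. \<forall>y\<in>M. dist (f x) (f y) \<le> L * dist x y powr \<alpha>)"

definition B_set :: "real \<Rightarrow> 'a::metric_space itself \<Rightarrow> 'b::metric_space itself \<Rightarrow> real set" where
  "B_set C (_ :: 'a itself) (_ :: 'b itself) =
     {\<alpha>. 0 < \<alpha> \<and> \<alpha> \<le> 1 \<and>
        (\<forall>L>0. \<forall>(M :: 'a set) (f :: 'a \<Rightarrow> 'b). holder_on L \<alpha> M f \<longrightarrow>
           (\<exists>g :: 'a \<Rightarrow> 'b. holder_on (C * L) \<alpha> UNIV g \<and> (\<forall>x\<in>M. g x = f x)))}"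

definition A_tilde :: "'a::metric_space itself \<Rightarrow> 'b::metric_space itself \<Rightarrow> real set" where
  "A_tilde X Y = (\<Inter>C\<in>{1<..}. B_set C X Y)"

text \<open>
  On a compact space every continuous real function is bounded, so for compact \<open>'k\<close> the type
  \<open>'k \<Rightarrow>\<^sub>C real\<close> is the space $C(K)$ with the supremum norm.
\<close>

lemma bcontfun_compact:
  fixes f :: "'k::topological_space \<Rightarrow> real"
  assumes "compact (UNIV :: 'k set)"
  shows "f \<in> bcontfun \<longleftrightarrow> continuous_on UNIV f"
  using assms by (auto simp: bcontfun_def intro: compact_imp_bounded compact_continuous_image)

end

theory Submission
  imports Defs
begin

text \<open>
  In \<open>C(K)\<close>, and coordinatewise in \<open>\<ell>\<^sub>\<infinity>\<^sup>n\<close>, finitely many pairwise intersecting balls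
  contain the maximum of the functions centre minus radius. An \<open>\<L>\<^sup>\<infinity>\<close> space for every
  constant inherits this up to enlarging the radii by a factor \<open>l > 1\<close>.

  Values in a space with almost the finite intersection property for balls can be prescribed at one
  more point \<open>x\<close>: the balls of centre \<open>f m\<close> and radius \<open>L' * dist x m powr \<alpha>\<close>, \<open>m \<in> M\<close>,
  must have a common point. Near \<open>x\<close> only a finite net of \<open>M\<close> matters, because \<open>x\<close> has positive
  distance from \<open>M\<close> and \<open>L' > L\<close> leaves some slack; for far away \<open>m\<close> the slack in the radius
  exceeds any constant, so that the condition at a single point suffices.
  Running through a dense sequence of points while letting the constant increase to \<open>C * L\<close>, and
  passing to the closure, gives the extension.
\<close>

section \<open>Almost intersecting balls\<close>

text \<open>A pair is compared with itself as well, so all radii in \<open>S\<close> are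
  nonnegative. The factor \<open>l\<close> absorbs the distortion of an almost isometry with
  \<open>ell_infty n\<close>.\<close>

definition finite_ball_intersection :: "'b::metric_space itself \<Rightarrow> bool" where
  "finite_ball_intersection (_ :: 'b itself) \<longleftrightarrow>
     (\<forall>l>1. \<forall>S :: ('b \<times> real) set. finite S \<longrightarrow>
        (\<forall>(y, r)\<in>S. \<forall>(y', r')\<in>S. dist y y' \<le> r + r') \<longrightarrow>
        (\<exists>z. \<forall>(y, r)\<in>S. dist z y \<le> l * r))"

section \<open>Balls of bounded continuous functions\<close>

text \<open>This is the pointwise maximum of the functions \<open>u - s\<close>, encoded as an upper
  bound that is attained at every point. A binary maximum stays bounded and continuous, so induction
  on \<open>S\<close> builds it.\<close>

lemma bcontfun_Max_diff_exists:
  fixes S :: "(('k::topological_space \<Rightarrow>\<^sub>C real) \<times> real) set"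
  assumes "finite S" "S \<noteq> {}"
  shows "\<exists>z :: 'k \<Rightarrow>\<^sub>C real. \<forall>x. (\<forall>(u, s)\<in>S. apply_bcontfun u x - s \<le> apply_bcontfun z x) \<and>
    (\<exists>(u, s)\<in>S. apply_bcontfun z x = apply_bcontfun u x - s)"
  using assms
proof (induction rule: finite_ne_induct)
  case (singleton p)
  have "(\<lambda>x. fst p x - snd p) \<in> bcontfun"
    using minus_cont[OF apply_bcontfun const_bcontfun] .
  then show ?case
    by (intro exI[of _ "Bcontfun (\<lambda>x. fst p x - snd p)"]) (auto simp: Bcontfun_inverse split: prod.splits)
next
  case (insert p S)
  then obtain z :: "'k \<Rightarrow>\<^sub>C real"
    where z: "\<And>x. (\<forall>(u, s)\<in>S. apply_bcontfun u x - s \<le> apply_bcontfun z x) \<and>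
      (\<exists>(u, s)\<in>S. apply_bcontfun z x = apply_bcontfun u x - s)"
    by blast
  let ?v = "\<lambda>x. fst p x - snd p"
  have v: "?v \<in> bcontfun"
    using minus_cont[OF apply_bcontfun const_bcontfun] .
  have "(\<lambda>x. max (z x) (?v x)) \<in> bcontfun"
  proof -
    have "bounded (range z \<union> range ?v)"
      using v apply_bcontfun[of z] by (auto simp: bcontfun_def)
    moreover have "range (\<lambda>x. max (z x) (?v x)) \<subseteq> range z \<union> range ?v"
      by (auto simp: max_def)
    ultimately have "bounded (range (\<lambda>x. max (z x) (?v x)))"
      by (rule bounded_subset)
    then show ?thesis
      using v by (simp add: bcontfun_def continuous_on_max)
  qed
  then have ap: "apply_bcontfun (Bcontfun (\<lambda>x. max (z x) (?v x))) = (\<lambda>x. max (z x) (?v x))"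
    by (rule Bcontfun_inverse)
  show ?case
  proof (intro exI[of _ "Bcontfun (\<lambda>x. max (z x) (?v x))"] allI)
    fix x
    have "\<forall>(u, s)\<in>S. apply_bcontfun u x - s \<le> apply_bcontfun z x"
      "\<exists>(u, s)\<in>S. apply_bcontfun z x = apply_bcontfun u x - s"
      using z by blast+
    then show "(\<forall>(u, s)\<in>insert p S. apply_bcontfun u x - s \<le> apply_bcontfun (Bcontfun (\<lambda>x. max (z x) (?v x))) x) \<and>
        (\<exists>(u, s)\<in>insert p S. apply_bcontfun (Bcontfun (\<lambda>x. max (z x) (?v x))) x = apply_bcontfun u x - s)"
      unfolding ap by (fastforce simp: max_def)
  qed
qed

text \<open>The maximum \<open>z\<close> satisfies \<open>u - s \<le> z\<close>; where it is
  attained by \<open>v - t\<close>, the bound \<open>dist u v \<le> s + t\<close> yields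
  \<open>z \<le> u + s\<close>.\<close>

lemma bcontfun_balls_intersect:
  fixes S :: "(('k::topological_space \<Rightarrow>\<^sub>C real) \<times> real) set"
  assumes "finite S" and meet: "\<And>u s v t. (u, s) \<in> S \<Longrightarrow> (v, t) \<in> S \<Longrightarrow> dist u v \<le> s + t"
  shows "\<exists>z. \<forall>(u, s)\<in>S. dist z u \<le> s"
proof (cases "S = {}")
  case False
  then obtain z :: "'k \<Rightarrow>\<^sub>C real"
    where z: "\<And>x. (\<forall>(u, s)\<in>S. apply_bcontfun u x - s \<le> apply_bcontfun z x) \<and>
      (\<exists>(u, s)\<in>S. apply_bcontfun z x = apply_bcontfun u x - s)"
    using bcontfun_Max_diff_exists[OF assms(1)] by blast
  have "dist z u \<le> s" if us: "(u, s) \<in> S" for u s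
  proof (rule dist_bound)
    fix x
    obtain v t where vt: "(v, t) \<in> S" "z x = v x - t"
      using z[of x] by blast
    have "\<bar>u x - v x\<bar> \<le> s + t"
      using dist_bounded[of u x v] meet[OF us vt(1)] by (simp add: dist_real_def)
    moreover have "u x - s \<le> z x"
      using z[of x] us by blast
    ultimately show "dist (z x) (u x) \<le> s"
      using vt(2) by (simp add: dist_real_def)
  qed
  then show ?thesis by blast
qed simp

lemma finite_ball_intersection_bcontfun:
  "finite_ball_intersection TYPE('k::topological_space \<Rightarrow>\<^sub>C real)"
  unfolding finite_ball_intersection_def
proof (intro allI impI)
  fix l :: real and S :: "(('k \<Rightarrow>\<^sub>C real) \<times> real) set"
  assume l: "1 < l" and S: "finite S" "\<forall>(y, r)\<in>S. \<forall>(y', r')\<in>S. dist y y' \<le> r + r'"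
  have "\<exists>z. \<forall>(u, s)\<in>S. dist z u \<le> s"
    using S by (intro bcontfun_balls_intersect) blast+
  then obtain z where z: "\<forall>(u, s)\<in>S. dist z u \<le> s" by blast
  have "dist z u \<le> l * s" if "(u, s) \<in> S" for u s
  proof -
    have "dist z u \<le> s" using z that by blast
    moreover from this have "0 \<le> s" using zero_le_dist order_trans by blast
    then have "s \<le> l * s" using l by (simp add: mult_le_cancel_right1)
    ultimately show ?thesis by linarith
  qed
  then show "\<exists>z. \<forall>(u, s)\<in>S. dist z u \<le> l * s" by blast
qed

text \<open>
  The library has the instance \<open>complete_space\<close> for bounded continuous functions only on metric spaces.
  This is why completeness appears below as a hypothesis instead of a type class.
\<close>

lemma complete_UNIV_bcontfun:
  "complete (UNIV :: ('k::topological_space \<Rightarrow>\<^sub>C 'b::complete_space) set)"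
  unfolding complete_def
proof (intro allI impI)
  fix f :: "nat \<Rightarrow> 'k \<Rightarrow>\<^sub>C 'b"
  assume "(\<forall>n. f n \<in> UNIV) \<and> Cauchy f"
  then have cauchy: "Cauchy f" ..
  \<comment> \<open>\<open>True\<close> is the trivial instance of the predicate in
    \<open>uniformly_convergent_eq_cauchy\<close>.\<close>
  have "\<forall>e>0. \<exists>N. \<forall>m n x. N \<le> m \<and> N \<le> n \<and> True \<longrightarrow> dist (f m x) (f n x) < e"
  proof (intro allI impI)
    fix e :: real assume "0 < e"
    with cauchy obtain N where N: "\<And>m n. N \<le> m \<Longrightarrow> N \<le> n \<Longrightarrow> dist (f m) (f n) < e"
      by (meson Cauchy_def)
    have "dist (f m x) (f n x) < e" if "N \<le> m \<and> N \<le> n \<and> True" for m n x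
      using that by (intro dist_fun_lt_imp_dist_val_lt N) auto
    then show "\<exists>N. \<forall>m n x. N \<le> m \<and> N \<le> n \<and> True \<longrightarrow> dist (f m x) (f n x) < e"
      by blast
  qed
  then obtain g where
    "\<forall>e>0. \<exists>N. \<forall>n x. N \<le> n \<and> True \<longrightarrow> dist (f n x) (g x) < e"
    unfolding uniformly_convergent_eq_cauchy[symmetric] by (rule exE)
  then have "uniform_limit UNIV f g sequentially"
    by (simp add: uniform_limit_sequentially_iff)
  from uniform_limit_bcontfunE[OF this sequentially_bot] obtain l where "f \<longlonglongrightarrow> l"
    by metis
  then show "\<exists>l\<in>UNIV. f \<longlonglongrightarrow> l"
    by blast
qed

section \<open>Balls in spaces that are locally close to \<open>ell_infty n\<close>\<close>

lemma onorm_on_bounds: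
  assumes "bounded_linear_on E T" "0 \<in> E"
  shows "0 \<le> onorm_on E T" and "\<And>x. x \<in> E \<Longrightarrow> norm (T x) \<le> onorm_on E T * norm x"
proof -
  obtain K where K: "\<And>x. x \<in> E \<Longrightarrow> norm (T x) \<le> norm x * K"
    using assms(1) unfolding bounded_linear_on_def by blast
  \<comment> \<open>\<open>K\<close> can be negative if \<open>E\<close> is the zero space, hence
    the absolute value. At \<open>0\<close> the quotient is \<open>0\<close>.\<close>
  have "norm (T x) / norm x \<le> \<bar>K\<bar>" if "x \<in> E" for x
  proof (cases "x = 0")
    case False
    have "norm (T x) \<le> norm x * \<bar>K\<bar>"
      using K[OF that] by (meson abs_ge_self mult_left_mono norm_ge_zero order_trans)
    with False show ?thesis by (simp add: divide_le_eq mult.commute)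
  qed simp
  then have bdd: "bdd_above ((\<lambda>x. norm (T x) / norm x) ` E)"
    by (auto simp: bdd_above_def)
  show "0 \<le> onorm_on E T"
    using cSUP_upper[OF assms(2) bdd] by (simp add: onorm_on_def)
  fix x assume x: "x \<in> E"
  show "norm (T x) \<le> onorm_on E T * norm x"
  proof (cases "x = 0")
    case True
    then show ?thesis using K[OF x] by simp
  next
    case False
    then show ?thesis
      using cSUP_upper[OF x bdd] by (simp add: onorm_on_def divide_le_eq)
  qed
qed

lemma subspace_ell_infty: "subspace (ell_infty n)"
  by (auto simp: subspace_def ell_infty_def)

text \<open>A common point among all bounded sequences can be truncated after the first
  \<open>n\<close> indices: the centres vanish beyond, and the radii are nonnegative.\<close>

lemma ell_infty_balls_intersect:
  assumes "finite S" "S \<subseteq> ell_infty n \<times> UNIV"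
    and meet: "\<And>u s v t. (u, s) \<in> S \<Longrightarrow> (v, t) \<in> S \<Longrightarrow> dist u v \<le> s + t"
  shows "\<exists>z\<in>ell_infty n. \<forall>(u, s)\<in>S. dist z u \<le> s"
proof -
  obtain z where z: "\<forall>(u, s)\<in>S. dist z u \<le> s"
    using bcontfun_balls_intersect[OF assms(1) meet] by blast
  define w where "w = Bcontfun (\<lambda>k. if k < n then apply_bcontfun z k else 0)"
  have "(\<lambda>k. if k < n then apply_bcontfun z k else 0) \<in> bcontfun"
    by (rule bcontfun_normI[where b = "norm z"]) (auto simp: norm_bounded[of z, simplified])
  then have w: "apply_bcontfun w k = (if k < n then apply_bcontfun z k else 0)" for k
    by (simp add: w_def Bcontfun_inverse)
  have "dist w u \<le> s" if us: "(u, s) \<in> S" for u s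
  proof (rule dist_bound)
    fix k
    have zu: "dist z u \<le> s" using z us by blast
    then have "0 \<le> s" using zero_le_dist order_trans by blast
    moreover have "u \<in> ell_infty n" using assms(2) us by auto
    ultimately show "dist (apply_bcontfun w k) (apply_bcontfun u k) \<le> s"
      using zu dist_bounded[of z k u] by (auto simp: w ell_infty_def)
  qed
  moreover have "w \<in> ell_infty n" by (simp add: ell_infty_def w)
  ultimately show ?thesis by blast
qed

text \<open>All centres lie in one \<open>F\<close> that is \<open>l\<close>-isomorphic to
  \<open>ell_infty n\<close>. The balls of radius \<open>a * r\<close> around their images under
  \<open>T\<close> still meet; pulling a common point back multiplies distances by at most
  \<open>b\<close>, and \<open>a * b \<le> l\<close>.\<close>

lemma finite_ball_intersection_script_L_infty:
  assumes "\<forall>l>1. script_L_infty l TYPE('y::banach)"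
  shows "finite_ball_intersection TYPE('y)"
  unfolding finite_ball_intersection_def
proof (intro allI impI)
  fix l :: real and S :: "('y \<times> real) set"
  assume l: "1 < l" and S: "finite S" "\<forall>(y, r)\<in>S. \<forall>(y', r')\<in>S. dist y y' \<le> r + r'"
  have "fin_dim_subspace (span (fst ` S))"
    using S(1) by (auto simp: fin_dim_subspace_def)
  then obtain F where F: "fin_dim_subspace F" "span (fst ` S) \<subseteq> F"
      "lambda_isomorphic l F (ell_infty (dim F))"
    using assms l unfolding script_L_infty_def by blast
  define n where "n = dim F"
  obtain T where T: "bij_betw T F (ell_infty n)" "bounded_linear_on F T"
      "bounded_linear_on (ell_infty n) (inv_into F T)"
      "onorm_on F T * onorm_on (ell_infty n) (inv_into F T) \<le> l"
    using F(3) unfolding lambda_isomorphic_def n_def by blast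
  define a b where "a = onorm_on F T" and "b = onorm_on (ell_infty n) (inv_into F T)"
  have sub: "subspace F" using F(1) by (simp add: fin_dim_subspace_def)
  note Tb = onorm_on_bounds[OF T(2) subspace_0[OF sub], folded a_def]
  note Ib = onorm_on_bounds[OF T(3) subspace_0[OF subspace_ell_infty], folded b_def]
  have SF: "y \<in> F" if "(y, r) \<in> S" for y r
    using F(2) that by (force intro: span_base)
  have TF: "T y \<in> ell_infty n" if "y \<in> F" for y
    using T(1) that by (auto simp: bij_betw_def)
  have add: "T (x + y) = T x + T y" if "x \<in> F" "y \<in> F" for x y
    using T(2) that by (simp add: bounded_linear_on_def)
  have diff: "T (x - y) = T x - T y" if "x \<in> F" "y \<in> F" for x y
    using add[of "x - y" y] that subspace_diff[OF sub] by (simp add: algebra_simps)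
  have "dist (T y) (T y') \<le> a * r + a * r'" if "(y, r) \<in> S" "(y', r') \<in> S" for y r y' r'
  proof -
    have "dist (T y) (T y') \<le> a * dist y y'"
      using Tb(2)[of "y - y'"] SF that subspace_diff[OF sub] by (simp add: dist_norm diff)
    also have "\<dots> \<le> a * (r + r')"
      using S(2) that Tb(1) by (intro mult_left_mono) blast+
    finally show ?thesis by (simp add: algebra_simps)
  qed
  then have "\<exists>z\<in>ell_infty n. \<forall>(u, s)\<in>(\<lambda>(y, r). (T y, a * r)) ` S. dist z u \<le> s"
    using S(1) SF TF by (intro ell_infty_balls_intersect) fastforce+
  then obtain z where z: "z \<in> ell_infty n" "\<And>y r. (y, r) \<in> S \<Longrightarrow> dist z (T y) \<le> a * r"
    by fast
  define w where "w = inv_into F T z"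
  have w: "w \<in> F" "T w = z"
    using T(1) z(1) by (auto simp: w_def bij_betw_def f_inv_into_f inv_into_into)
  have "dist w y \<le> l * r" if yr: "(y, r) \<in> S" for y r
  proof -
    have yF: "y \<in> F" "w - y \<in> F"
      using SF[OF yr] w(1) subspace_diff[OF sub] by auto
    have "w - y = inv_into F T (T (w - y))"
      using T(1) yF by (simp add: bij_betw_def inv_into_f_f)
    then have "norm (w - y) \<le> b * norm (T (w - y))"
      using Ib(2)[OF TF[OF yF(2)]] by simp
    also have "T (w - y) = z - T y"
      using diff w yF by simp
    also have "b * norm (z - T y) \<le> b * (a * r)"
      using z(2)[OF yr] Ib(1) by (intro mult_left_mono) (auto simp: dist_norm)
    also have "\<dots> \<le> l * r"
    proof -
      have "dist y y \<le> r + r" using S(2) yr by blast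
      then have "0 \<le> r" by simp
      moreover have "a * b \<le> l" using T(4) by (simp add: a_def b_def)
      ultimately show ?thesis using mult_right_mono[of "a * b" l r] by (simp add: algebra_simps)
    qed
    finally show ?thesis by (simp add: dist_norm)
  qed
  then show "\<exists>z. \<forall>(y, r)\<in>S. dist z y \<le> l * r" by blast
qed

section \<open>Extension to one more point\<close>

text \<open>For \<open>0 \<le> t \<le> a + b\<close> the ratio \<open>t / (a + b)\<close> is at most
  1, so raising it to a power \<open>p \<le> 1\<close> does not decrease it. The cases
  \<open>t = a\<close> and \<open>t = b\<close> add up to the claim.\<close>

lemma powr_add_le_add_powr:
  fixes a b p :: real
  assumes "0 \<le> a" "0 \<le> b" "0 < p" "p \<le> 1"
  shows "(a + b) powr p \<le> a powr p + b powr p"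
proof (cases "a + b = 0")
  case False
  then have s: "0 < a + b" using assms by linarith
  have *: "t / (a + b) \<le> t powr p / (a + b) powr p" if "0 \<le> t" "t \<le> a + b" for t
  proof -
    have "t / (a + b) \<le> (t / (a + b)) powr p"
      using powr_mono'[of p 1 "t / (a + b)"] that s assms by (simp add: divide_le_eq)
    then show ?thesis using that s by (simp add: powr_divide)
  qed
  have "1 = a / (a + b) + b / (a + b)"
    using s by (simp flip: add_divide_distrib)
  also have "\<dots> \<le> (a powr p + b powr p) / (a + b) powr p"
    using *[of a] *[of b] assms by (simp add: add_divide_distrib)
  finally show ?thesis using s by (simp add: le_divide_eq)
qed (use assms in simp)

text \<open>This lets Hoelder maps be treated like Lipschitz maps for the distance
  \<open>dist x y powr p\<close>.\<close>

lemma dist_powr_triangle: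
  fixes x y z :: "'a::metric_space"
  assumes "0 < p" "p \<le> 1"
  shows "dist x z powr p \<le> dist x y powr p + dist y z powr p"
proof -
  have "dist x z powr p \<le> (dist x y + dist y z) powr p"
    using assms dist_triangle[of x z y] by (intro powr_mono2) auto
  also have "\<dots> \<le> dist x y powr p + dist y z powr p"
    using assms by (intro powr_add_le_add_powr) auto
  finally show ?thesis .
qed

text \<open>The centres have to be points of \<open>M\<close>, as a Hoelder bound will be available
  only there. Balls around them cover \<open>closure M\<close>, which is compact as a closed part of
  \<open>K\<close>.\<close>

lemma finite_net_subset:
  fixes M :: "'a::metric_space set"
  assumes "compact K" "M \<subseteq> K" "0 < e"
  obtains N where "finite N" "N \<subseteq> M" "\<And>m. m \<in> M \<Longrightarrow> \<exists>i\<in>N. dist m i < e"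
proof -
  have "compact (closure M)"
    using assms closure_minimal[OF assms(2) compact_imp_closed]
    by (metis closed_closure compact_Int_closed inf.absorb2)
  moreover have "closure M \<subseteq> (\<Union>i\<in>M. ball i e)"
    using assms(3) by (auto simp: closure_approachable)
  ultimately obtain N where N: "N \<subseteq> M" "finite N" "closure M \<subseteq> (\<Union>i\<in>N. ball i e)"
    using compactE_image[of "closure M" M "\<lambda>i. ball i e"] by auto
  show thesis
  proof
    fix m assume "m \<in> M"
    then have "m \<in> (\<Union>i\<in>N. ball i e)" using N(3) closure_subset by blast
    then show "\<exists>i\<in>N. dist m i < e" by (auto simp: dist_commute)
  qed (use N in auto)
qed

text \<open>Outside \<open>closure M\<close> the point \<open>x\<close> has a positive distance
  \<open>\<delta>\<close> to \<open>M\<close>, which bounds the radii from below and so makes a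
  finite net precise enough.\<close>

lemma holder_one_point_extension:
  fixes f :: "'a::metric_space \<Rightarrow> 'b::metric_space"
  assumes proper: "\<And>r. compact (cball x r)"
    and fbi: "finite_ball_intersection TYPE('b)"
    and f: "holder_on L \<alpha> M f" and \<alpha>: "0 < \<alpha>" "\<alpha> \<le> 1" and L: "0 < L" "L < L'"
    and x: "x \<notin> closure M"
  obtains y where "\<And>m. m \<in> M \<Longrightarrow> dist y (f m) \<le> L' * dist x m powr \<alpha>"
proof (cases "M = {}")
  case False
  then obtain m0 where m0: "m0 \<in> M" by blast
  obtain \<delta> where \<delta>: "0 < \<delta>" "\<And>m. m \<in> M \<Longrightarrow> \<delta> \<le> dist x m"
    using x by (force simp: closure_approachable dist_commute not_less)
  define a where "a m = dist x m powr \<alpha>" for m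
  \<comment> \<open>The gap from \<open>L\<close> to \<open>L1\<close> pays for the factor lost in
    the intersection property, the gap from \<open>L1\<close> to \<open>L'\<close> for replacing a
    point by a nearby net point.\<close>
  define L1 where "L1 = (L + L') / 2"
  have L1: "L < L1" "L1 < L'" using L by (auto simp: L1_def)
  \<comment> \<open>Passing from \<open>m\<close> to \<open>m0\<close> costs
    \<open>(L + L1) * a m0\<close>, which the slack \<open>(L' - L) * a m\<close> covers beyond
    \<open>R\<close>. Moving to a net point closer than \<open>e\<close> costs at most
    \<open>(L + L1) * e powr \<alpha>\<close>, chosen equal to
    \<open>(L' - L1) * \<delta> powr \<alpha>\<close>.\<close>
  define R where "R = ((L + L1) * a m0 / (L' - L)) powr (1 / \<alpha>)"
  define e where "e = ((L' - L1) * \<delta> powr \<alpha> / (L + L1)) powr (1 / \<alpha>)"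
  have R: "(L + L1) * a m0 \<le> (L' - L) * a m" if "R \<le> dist x m" for m
  proof -
    have "R powr \<alpha> \<le> a m"
      unfolding a_def using that \<alpha> by (intro powr_mono2) (auto simp: R_def)
    moreover have "R powr \<alpha> = (L + L1) * a m0 / (L' - L)"
      using \<alpha> L L1 by (simp add: R_def powr_powr a_def)
    ultimately show ?thesis using L by (simp add: divide_le_eq mult.commute)
  qed
  have e: "0 < e" "(L + L1) * e powr \<alpha> = (L' - L1) * \<delta> powr \<alpha>"
    using \<alpha> L L1 \<delta>(1) by (auto simp: e_def powr_powr)
  obtain N where N: "finite N" "N \<subseteq> M \<inter> cball x R"
      "\<And>m. m \<in> M \<inter> cball x R \<Longrightarrow> \<exists>i\<in>N. dist m i < e"
    using finite_net_subset[OF proper _ e(1), of "M \<inter> cball x R" R] by blast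
  have hol: "dist (f i) (f j) \<le> L * dist i j powr \<alpha>" if "i \<in> M" "j \<in> M" for i j
    using f that by (simp add: holder_on_def)
  have tri: "dist i j powr \<alpha> \<le> a i + a j" for i j
    using dist_powr_triangle[OF \<alpha>, of i j x] by (simp add: a_def dist_commute)
  \<comment> \<open>\<open>m0\<close> joins the net because it serves all points farther than
    \<open>R\<close>. The triangle inequality through \<open>x\<close> makes these balls meet
    pairwise.\<close>
  define S where "S = (\<lambda>m. (f m, L * a m)) ` insert m0 N"
  have "dist (f i) (f j) \<le> L * a i + L * a j" if "i \<in> insert m0 N" "j \<in> insert m0 N" for i j
  proof -
    have "dist (f i) (f j) \<le> L * dist i j powr \<alpha>"
      using that N(2) m0 by (intro hol) auto
    also have "\<dots> \<le> L * (a i + a j)" using L tri by (intro mult_left_mono) auto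
    finally show ?thesis by (simp add: algebra_simps)
  qed
  then have "\<forall>(y, r)\<in>S. \<forall>(y', r')\<in>S. dist y y' \<le> r + r'"
    unfolding S_def by (simp only: ball_simps prod.case) blast
  moreover have "finite S" "1 < L1 / L" using N(1) L L1 by (auto simp: S_def)
  ultimately obtain y where "\<forall>(u, r)\<in>S. dist y u \<le> L1 / L * r"
    using fbi unfolding finite_ball_intersection_def by meson
  then have y: "dist y (f i) \<le> L1 * a i" if "i \<in> insert m0 N" for i
    using that L(1) by (auto simp: S_def)
  have "dist y (f m) \<le> L' * a m" if m: "m \<in> M" for m
  proof (cases "dist x m \<le> R")
    case True
    with m N(3)[of m] obtain i where i: "i \<in> N" "dist m i < e" by auto
    have iM: "i \<in> M" using i N by auto
    have ei: "dist i m powr \<alpha> \<le> e powr \<alpha>"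
      using i \<alpha> by (intro powr_mono2) (auto simp: dist_commute)
    have "a i \<le> a m + dist i m powr \<alpha>"
      using dist_powr_triangle[OF \<alpha>, of x i m] by (simp add: a_def dist_commute)
    with ei have "L1 * a i \<le> L1 * (a m + e powr \<alpha>)"
      using L L1 by (intro mult_left_mono) auto
    moreover have "L * dist i m powr \<alpha> \<le> L * e powr \<alpha>"
      using ei L by simp
    moreover have "dist y (f m) \<le> dist y (f i) + dist (f i) (f m)" by (rule dist_triangle)
    ultimately have "dist y (f m) \<le> L1 * a m + (L + L1) * e powr \<alpha>"
      using hol[OF iM m] y[of i] i(1) by (auto simp: algebra_simps)
    also have "\<dots> \<le> L1 * a m + (L' - L1) * a m"
      unfolding e(2) a_def using \<delta> m L1 \<alpha> by (intro add_left_mono mult_left_mono powr_mono2) auto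
    finally show ?thesis by (simp add: algebra_simps)
  next
    case False
    have "L * dist m0 m powr \<alpha> \<le> L * (a m0 + a m)"
      using L tri by simp
    moreover have "dist y (f m) \<le> dist y (f m0) + dist (f m0) (f m)" by (rule dist_triangle)
    ultimately show ?thesis
      using R[of m] False y[of m0] hol[OF m0 m] by (simp add: algebra_simps)
  qed
  then show thesis using that by (auto simp: a_def)
qed (use that in auto)

section \<open>Extension to the whole space\<close>

text \<open>Finite nets of mesh \<open>1 / Suc n\<close> in the balls of radius \<open>n\<close>
  around a fixed point have a countable dense union.\<close>

lemma proper_imp_dense_sequence:
  assumes "\<And>(x::'a::metric_space) r. compact (cball x r)"
  obtains d :: "nat \<Rightarrow> 'a::metric_space" where "closure (range d) = UNIV"
proof -
  obtain x0 :: 'a where True by blast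
  have "\<exists>N. finite N \<and> (\<forall>m\<in>cball x0 (real n). \<exists>i\<in>N. dist m i < 1 / real (Suc n))" for n
    by (rule finite_net_subset[OF assms[of x0 n], of "cball x0 n" "1 / Suc n"]) auto
  then obtain N where N: "\<And>n. finite (N n)"
      "\<And>n m. m \<in> cball x0 (real n) \<Longrightarrow> \<exists>i\<in>N n. dist m i < 1 / real (Suc n)"
    by metis
  define D where "D = (\<Union>n. N n)"
  have dense: "\<exists>i\<in>D. dist i m < e" if "0 < e" for m e
  proof -
    obtain k1 k2 :: nat where k: "dist x0 m \<le> real k1" "1 / e < real k2"
      using real_arch_simple reals_Archimedean2 by meson
    define n where "n = max k1 k2"
    have "1 / e < real (Suc n)" "dist x0 m \<le> real n" using k by (auto simp: n_def)
    then obtain i where "i \<in> N n" "dist m i < 1 / real (Suc n)" using N(2)[of m n] by auto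
    moreover have "1 / real (Suc n) < e"
      using \<open>1 / e < real (Suc n)\<close> that by (simp add: field_simps)
    ultimately show ?thesis unfolding D_def by (force simp: dist_commute)
  qed
  have "closure D = UNIV" by (auto simp: closure_approachable dense)
  moreover have "D \<noteq> {}" using dense zero_less_one by blast
  moreover have "countable D" using N(1) by (auto simp: D_def intro: countable_finite)
  ultimately show thesis using that[of "from_nat_into D"] by simp
qed

text \<open>Uniform continuity and completeness give limits along Cauchy sequences. One sequence is
  fixed for each point, with limit value \<open>f x\<close> on \<open>M\<close>, and the inequality
  passes to the limit with the same \<open>L\<close>.\<close>

lemma holder_extends_to_closure:
  fixes f :: "'a::metric_space \<Rightarrow> 'b::metric_space"
  assumes f: "holder_on L \<alpha> M f" and "0 < \<alpha>" "0 < L" and compl: "complete (UNIV :: 'b set)"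
  obtains g where "holder_on L \<alpha> (closure M) g" "\<And>x. x \<in> M \<Longrightarrow> g x = f x"
proof -
  have ucont: "uniformly_continuous_on M f"
    unfolding uniformly_continuous_on_def
  proof (intro allI impI)
    fix e :: real assume "0 < e"
    define d where "d = (e / L) powr (1 / \<alpha>)"
    have d: "0 < d" "L * d powr \<alpha> = e"
      using \<open>0 < e\<close> assms(2,3) by (auto simp: d_def powr_powr)
    have "dist (f x') (f x) < e" if "x \<in> M" "x' \<in> M" "dist x' x < d" for x x'
    proof -
      have "dist (f x') (f x) \<le> L * dist x' x powr \<alpha>" using f that by (simp add: holder_on_def)
      also have "\<dots> < L * d powr \<alpha>" using that assms(2,3) by (simp add: powr_less_mono2)
      finally show ?thesis using d by simp
    qed
    with d(1) show "\<exists>d>0. \<forall>x\<in>M. \<forall>x'\<in>M. dist x' x < d \<longrightarrow> dist (f x') (f x) < e" by blast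
  qed
  have uc: "Cauchy (f \<circ> u)" if "Cauchy u" "\<And>n. u n \<in> M" for u
    using uniformly_continuous_imp_Cauchy_continuous[OF ucont] that
    unfolding Cauchy_continuous_on_def by blast
  have "\<exists>u l. (\<forall>n. u n \<in> M) \<and> u \<longlonglongrightarrow> x \<and> (f \<circ> u) \<longlonglongrightarrow> l \<and> (x \<in> M \<longrightarrow> l = f x)"
    if x: "x \<in> closure M" for x
  proof (cases "x \<in> M")
    case True
    then show ?thesis by (intro exI[of _ "\<lambda>_. x"] exI[of _ "f x"]) (simp add: o_def)
  next
    case False
    obtain u where u: "\<And>n. u n \<in> M" "u \<longlonglongrightarrow> x"
      using x by (metis closure_sequential)
    then have "Cauchy (f \<circ> u)" using uc LIMSEQ_imp_Cauchy by blast
    then obtain l where "(f \<circ> u) \<longlonglongrightarrow> l" using compl unfolding complete_def by blast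
    with u False show ?thesis by blast
  qed
  then have "\<forall>x\<in>closure M. \<exists>u l. (\<forall>n. u n \<in> M) \<and> u \<longlonglongrightarrow> x \<and> (f \<circ> u) \<longlonglongrightarrow> l \<and> (x \<in> M \<longrightarrow> l = f x)"
    by blast
  from bchoice[OF this] obtain u where
    "\<forall>x\<in>closure M. \<exists>l. (\<forall>n. u x n \<in> M) \<and> u x \<longlonglongrightarrow> x \<and> (f \<circ> u x) \<longlonglongrightarrow> l \<and> (x \<in> M \<longrightarrow> l = f x)"
    by blast
  from bchoice[OF this] obtain g where
    u: "\<And>x n. x \<in> closure M \<Longrightarrow> u x n \<in> M" "\<And>x. x \<in> closure M \<Longrightarrow> u x \<longlonglongrightarrow> x"
    and g: "\<And>x. x \<in> closure M \<Longrightarrow> (f \<circ> u x) \<longlonglongrightarrow> g x" "\<And>x. x \<in> closure M \<Longrightarrow> x \<in> M \<Longrightarrow> g x = f x"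
    by blast
  have "dist (g x) (g y) \<le> L * dist x y powr \<alpha>" if xy: "x \<in> closure M" "y \<in> closure M" for x y
  proof -
    have lhs: "(\<lambda>n. dist (f (u x n)) (f (u y n))) \<longlonglongrightarrow> dist (g x) (g y)"
      using tendsto_dist[OF g(1) g(1)] xy by (simp add: o_def)
    \<comment> \<open>\<open>0 < \<alpha>\<close> makes the power continuous at \<open>0\<close>
      too, which is the case \<open>x = y\<close>.\<close>
    have "(\<lambda>n. dist (u x n) (u y n) powr \<alpha>) \<longlonglongrightarrow> dist x y powr \<alpha>"
      using assms(2) xy by (intro tendsto_powr' tendsto_dist u tendsto_const) auto
    then have rhs: "(\<lambda>n. L * dist (u x n) (u y n) powr \<alpha>) \<longlonglongrightarrow> L * dist x y powr \<alpha>"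
      by (rule tendsto_mult_left)
    show ?thesis
      using f u xy by (intro LIMSEQ_le[OF lhs rhs]) (auto simp: holder_on_def)
  qed
  moreover have "g x = f x" if "x \<in> M" for x
    using g(2) that closure_subset by blast
  ultimately show thesis by (intro that[of g]) (auto simp: holder_on_def)
qed

lemma holder_on_mono:
  assumes "holder_on L \<alpha> M f" "L \<le> L'"
  shows "holder_on L' \<alpha> M f"
  using assms unfolding holder_on_def by (meson mult_right_mono order_trans powr_ge_zero)

lemma holder_extension_proper:
  fixes f :: "'a::metric_space \<Rightarrow> 'b::metric_space"
  assumes proper: "\<And>(x::'a) r. compact (cball x r)"
    and compl: "complete (UNIV :: 'b set)"
    and fbi: "finite_ball_intersection TYPE('b)"
    and f: "holder_on L \<alpha> M f" and \<alpha>: "0 < \<alpha>" "\<alpha> \<le> 1" and L: "0 < L" "1 < C"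
  obtains g where "holder_on (C * L) \<alpha> UNIV g" "\<And>x. x \<in> M \<Longrightarrow> g x = f x"
proof -
  obtain d :: "nat \<Rightarrow> 'a" where d: "closure (range d) = UNIV"
    using proper_imp_dense_sequence[OF proper] by blast
  \<comment> \<open>Each new point needs a strictly larger constant; these start at \<open>L\<close>
    and increase without exceeding \<open>C * L\<close>.\<close>
  define c where "c n = C * L - (C - 1) * L / 2 ^ n" for n :: nat
  have c0: "c 0 = L" by (simp add: c_def algebra_simps)
  have c_lt: "c n < c (Suc n)" and c_le: "c n \<le> C * L" for n
    using L by (auto simp: c_def field_simps)
  have c_pos: "0 < c n" for n
    using lift_Suc_mono_le[of c 0 n] c_lt c0 L by (simp add: less_imp_le less_le_trans)
  \<comment> \<open>The states are partial functions, as pairs of domain and map; the clause for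
    \<open>n = 0\<close> fixes the start at \<open>(M, f)\<close>.\<close>
  define P where "P n p \<longleftrightarrow> holder_on (c n) \<alpha> (fst p) (snd p) \<and> (n = 0 \<longrightarrow> p = (M, f))"
    for n and p :: "'a set \<times> ('a \<Rightarrow> 'b)"
  \<comment> \<open>A point \<open>d n\<close> already in the closure of the domain has no positive
    distance to it and is left to the final passage to the closure.\<close>
  define Q where "Q n p q \<longleftrightarrow> fst p \<subseteq> fst q \<and> (\<forall>x\<in>fst p. snd q x = snd p x) \<and> d n \<in> closure (fst q)"
    for n and p q :: "'a set \<times> ('a \<Rightarrow> 'b)"
  have "\<exists>s. \<forall>n. P n (s n) \<and> Q n (s n) (s (Suc n))"
  proof (rule dependent_nat_choice)
    show "\<exists>p. P 0 p" using f by (auto simp: P_def c0)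
  next
    fix p n assume "P n p"
    then obtain A h where p: "p = (A, h)" "holder_on (c n) \<alpha> A h" by (cases p) (auto simp: P_def)
    show "\<exists>q. P (Suc n) q \<and> Q n p q"
    proof (cases "d n \<in> closure A")
      case True
      then show ?thesis
        using p holder_on_mono[OF p(2) less_imp_le[OF c_lt]]
        by (intro exI[of _ p]) (auto simp: P_def Q_def)
    next
      case False
      then obtain y where y: "\<And>m. m \<in> A \<Longrightarrow> dist y (h m) \<le> c (Suc n) * dist (d n) m powr \<alpha>"
        using holder_one_point_extension[OF proper fbi p(2) \<alpha> c_pos c_lt] by blast
      have notin: "d n \<notin> A" using False closure_subset by blast
      have "holder_on (c (Suc n)) \<alpha> (insert (d n) A) (h(d n := y))"
        using y notin holder_on_mono[OF p(2) less_imp_le[OF c_lt]]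
        by (auto simp: holder_on_def dist_commute)
      then show ?thesis
        using notin closure_subset[of "insert (d n) A"] p(1)
        by (intro exI[of _ "(insert (d n) A, h(d n := y))"]) (auto simp: P_def Q_def)
    qed
  qed
  then obtain s where s: "\<And>n. P n (s n)" "\<And>n. Q n (s n) (s (Suc n))" by blast
  define A h where "A n = fst (s n)" and "h n = snd (s n)" for n
  have hA: "holder_on (c n) \<alpha> (A n) (h n)" and A0: "A 0 = M" "h 0 = f" for n
    using s(1)[of n] s(1)[of 0] by (auto simp: P_def A_def h_def)
  have mono: "A n \<subseteq> A (n + k) \<and> (\<forall>x\<in>A n. h (n + k) x = h n x)" for n k
  proof (induction k)
    case (Suc k)
    then show ?case using s(2)[of "n + k"] by (auto simp: Q_def A_def h_def)
  qed simp
  have mono': "A n \<subseteq> A m" "x \<in> A n \<Longrightarrow> h m x = h n x" if "n \<le> m" for n m x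
    using mono[of n "m - n"] that by auto
  define U where "U = (\<Union>n. A n)"
  \<comment> \<open>Later stages agree with earlier ones on the earlier domains, so the first stage
    containing \<open>x\<close> can define the value.\<close>
  define g0 where "g0 x = h (LEAST n. x \<in> A n) x" for x
  have g0: "g0 x = h n x" if "x \<in> A n" for x n
    unfolding g0_def using that mono'(2)[OF Least_le[of "\<lambda>n. x \<in> A n", OF that]]
      LeastI[of "\<lambda>n. x \<in> A n", OF that] by metis
  have "holder_on (C * L) \<alpha> U g0"
    unfolding holder_on_def
  proof (intro ballI)
    fix x y assume "x \<in> U" "y \<in> U"
    then obtain i j where "x \<in> A i" "y \<in> A j" by (auto simp: U_def)
    then have xy: "x \<in> A (max i j)" "y \<in> A (max i j)"
      using mono'(1)[of i "max i j"] mono'(1)[of j "max i j"] by auto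
    then show "dist (g0 x) (g0 y) \<le> C * L * dist x y powr \<alpha>"
      using holder_on_mono[OF hA c_le, of "max i j"] g0[OF xy(1)] g0[OF xy(2)]
      by (auto simp: holder_on_def)
  qed
  then obtain g where g: "holder_on (C * L) \<alpha> (closure U) g" "\<And>x. x \<in> U \<Longrightarrow> g x = g0 x"
    using holder_extends_to_closure[of "C * L" \<alpha> U g0] compl \<alpha> L by auto
  have "d n \<in> closure U" for n
  proof -
    have "d n \<in> closure (A (Suc n))" using s(2)[of n] by (simp add: Q_def A_def)
    then show ?thesis using closure_mono[of "A (Suc n)" U] by (auto simp: U_def)
  qed
  then have "closure U = UNIV"
    using d closure_minimal[of "range d" "closure U"] by auto
  moreover have "g x = f x" if "x \<in> M" for x
    using that A0 g(2)[of x] g0[of x 0] by (auto simp: U_def)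
  ultimately show thesis using g(1) that by simp
qed

section \<open>Balls in finite-dimensional spaces\<close>

text \<open>By induction \<open>span B\<close> is closed, so a new vector \<open>b\<close> outside
  it has a positive distance to it. This bounds the coefficient of \<open>b\<close> in terms of
  \<open>r\<close>, and the ball becomes a closed part of a continuous image of a compact
  product.\<close>

lemma compact_span_Int_cball:
  fixes B :: "'a::real_normed_vector set"
  assumes "finite B"
  shows "compact (span B \<inter> cball 0 r)"
  using assms
proof (induction arbitrary: r rule: finite_induct)
  case empty
  show ?case by (simp add: Int_insert_left)
next
  case (insert b B)
  show ?case
  proof (cases "b \<in> span B")
    case True
    then show ?thesis using insert.IH by (simp add: span_redundant)
  next
    case False
    have "closed (span B)"
      unfolding closed_sequential_limits
    proof (intro allI impI)
      fix u l assume u: "(\<forall>n. u n \<in> span B) \<and> u \<longlonglongrightarrow> l"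
      \<comment> \<open>A convergent sequence is bounded, hence stays in one of the compact
        balls.\<close>
      then obtain K where "\<And>n. norm (u n) \<le> K"
        using convergent_imp_Bseq[of u] by (auto simp: convergent_def Bseq_def)
      then have "\<forall>n. u n \<in> span B \<inter> cball 0 K" using u by simp
      moreover have "closed (span B \<inter> cball 0 K)" using insert.IH by (rule compact_imp_closed)
      ultimately show "l \<in> span B" using u unfolding closed_sequential_limits by blast
    qed
    then have "open (- span B)" by (rule open_Compl)
    then obtain d where d: "0 < d" "ball b d \<subseteq> - span B"
      using False by (auto simp: open_contains_ball)
    \<comment> \<open>Dividing by \<open>a\<close> turns the vector into the difference of
      \<open>b\<close> and an element of \<open>span B\<close>.\<close>
    have far: "\<bar>a\<bar> * d \<le> norm (a *\<^sub>R b + s)" if "s \<in> span B" for a s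
    proof (cases "a = 0")
      case False
      have "(- inverse a) *\<^sub>R s \<in> span B" using that by (rule span_scale)
      then have "d \<le> dist b ((- inverse a) *\<^sub>R s)" using d(2) by (force simp: not_le)
      also have "\<dots> = norm (inverse a *\<^sub>R (a *\<^sub>R b + s))"
        using False by (simp add: dist_norm scaleR_add_right)
      also have "\<dots> = norm (a *\<^sub>R b + s) / \<bar>a\<bar>"
        by (simp only: norm_scaleR abs_inverse divide_inverse mult.commute)
      finally show ?thesis using False by (simp add: le_divide_eq mult.commute)
    qed simp
    \<comment> \<open>The first radius comes from \<open>far\<close>, the second from the triangle
      inequality for \<open>x - a *\<^sub>R b\<close>.\<close>
    define Q where "Q = cball (0::real) (r / d) \<times> (span B \<inter> cball 0 (r + r / d * norm b))"
    have "compact ((\<lambda>(a, s). a *\<^sub>R b + s) ` Q)"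
      unfolding Q_def case_prod_unfold
      by (intro compact_continuous_image continuous_intros compact_Times insert.IH compact_cball)
    then have "compact ((\<lambda>(a, s). a *\<^sub>R b + s) ` Q \<inter> cball 0 r)"
      by (rule compact_Int_closed) simp
    moreover have "(\<lambda>(a, s). a *\<^sub>R b + s) ` Q \<inter> cball 0 r = span (insert b B) \<inter> cball 0 r"
    proof (intro equalityI subsetI)
      fix x assume "x \<in> (\<lambda>(a, s). a *\<^sub>R b + s) ` Q \<inter> cball 0 r"
      then show "x \<in> span (insert b B) \<inter> cball 0 r"
        using span_mono[of B "insert b B"]
        by (auto simp: Q_def intro!: span_add span_scale intro: span_base)
    next
      fix x assume x: "x \<in> span (insert b B) \<inter> cball 0 r"
      then obtain a where a: "x - a *\<^sub>R b \<in> span B" by (auto simp: span_insert)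
      have "\<bar>a\<bar> * d \<le> r" using far[OF a, of a] x by simp
      then have ad: "\<bar>a\<bar> \<le> r / d" using d(1) by (simp add: le_divide_eq)
      have "norm (x - a *\<^sub>R b) \<le> norm x + \<bar>a\<bar> * norm b"
        by (metis norm_scaleR norm_triangle_ineq4)
      also have "\<dots> \<le> r + r / d * norm b"
        using x ad by (intro add_mono mult_right_mono) auto
      finally have "(a, x - a *\<^sub>R b) \<in> Q" using a ad by (simp add: Q_def)
      then have "x \<in> (\<lambda>(a, s). a *\<^sub>R b + s) ` Q" by (rule rev_image_eqI) simp
      then show "x \<in> (\<lambda>(a, s). a *\<^sub>R b + s) ` Q \<inter> cball 0 r" using x by blast
    qed
    ultimately show ?thesis by simp
  qed
qed

lemma compact_cball_fin_dim:
  assumes "fin_dim_subspace (UNIV :: 'a::real_normed_vector set)"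
  shows "compact (cball (x::'a::real_normed_vector) r)"
proof -
  obtain B :: "'a set" where "finite B" "span B = UNIV"
    using assms by (auto simp: fin_dim_subspace_def)
  then have "compact (cball (0::'a) r)" using compact_span_Int_cball[of B r] by simp
  then have "compact ((+) x ` cball 0 r)" by (rule compact_translation)
  then show ?thesis by (simp add: cball_translation)
qed

section \<open>The set of admissible exponents\<close>

lemma A_tilde_eq_Ioc:
  assumes "fin_dim_subspace (UNIV :: 'x::real_normed_vector set)"
    and compl: "complete (UNIV :: 'y::metric_space set)"
    and fbi: "finite_ball_intersection TYPE('y)"
  shows "A_tilde TYPE('x) TYPE('y) = {0<..1}"
proof (intro equalityI subsetI)
  fix \<alpha> :: real assume "\<alpha> \<in> A_tilde TYPE('x) TYPE('y)"
  \<comment> \<open>Any constant above 1 would serve; the bounds on \<open>\<alpha>\<close> are part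
    of \<open>B_set\<close>.\<close>
  then have "\<alpha> \<in> B_set 2 TYPE('x) TYPE('y)" by (simp add: A_tilde_def)
  then show "\<alpha> \<in> {0<..1}" by (simp add: B_set_def)
next
  fix \<alpha> :: real assume \<alpha>: "\<alpha> \<in> {0<..1}"
  show "\<alpha> \<in> A_tilde TYPE('x) TYPE('y)"
    unfolding A_tilde_def B_set_def
  proof (clarsimp, intro conjI allI impI)
    fix C L :: real and M :: "'x set" and f :: "'x \<Rightarrow> 'y"
    assume "1 < C" "0 < L" "holder_on L \<alpha> M f"
    with \<alpha> obtain g where "holder_on (C * L) \<alpha> UNIV g" "\<And>x. x \<in> M \<Longrightarrow> g x = f x"
      using holder_extension_proper[OF compact_cball_fin_dim[OF assms(1)] compl fbi, of L \<alpha> M f C] by auto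
    then show "\<exists>g. holder_on (C * L) \<alpha> UNIV g \<and> (\<forall>x\<in>M. g x = f x)" by blast
  qed (use \<alpha> in auto)
qed

theorem proposition3p1:
  assumes "fin_dim_subspace (UNIV :: 'x::real_normed_vector set)"
  shows "((\<forall>l>1. script_L_infty l TYPE('y::banach)) \<longrightarrow>
            A_tilde TYPE('x) TYPE('y) = {0<..1}) \<and>
         (compact (UNIV :: 'k::topological_space set) \<longrightarrow>
            A_tilde TYPE('x) TYPE('k \<Rightarrow>\<^sub>C real) = {0<..1})"
  by (intro conjI impI A_tilde_eq_Ioc[OF assms] complete_UNIV complete_UNIV_bcontfun
      finite_ball_intersection_bcontfun finite_ball_intersection_script_L_infty)

end
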